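(* Let $S$ be a $*$-monoid and let $a,b,c\in S$. Then the following conditions are equivalent: (i) $a$ is $(b,c)$-core-EP invertible. (ii) There exist some $k\in\mathbb{N}$ and some $x\in (ca)^{k}bS$ such that $cax(ca)^{k}c=(ca)^{k}c$, $x(ca)^{k+1}b=(ca)^{k}b$, $(cax)^{*}=cax$ and $xcax=x$. (iii) There exist some $k\in\mathbb{N}$ and some $x\in (ca)^{k}bS$ such that $cax(ca)^{k}c=(ca)^{k}c$, $x(ca)^{k+1}b=(ca)^{k}b$ and $(cax)^{*}=cax$. (iv) There exist some $k\in\mathbb{N}$ and some $x\in (ca)^{k}bS$ such that $cax(ca)^{k}c=(ca)^{k}c$, $(ca)^{k}b\leq_{\mathcal L^{\rm o}}x$ and $x\leq_{\mathcal R^{\rm o}}((ca)^{k}c)^{*}$. (v) There exist some $x\in S$ and some $k\in\mathbb{N}$ such that $cax(ca)^{k}c=(ca)^{k}c$, $x\mathrel{\mathcal R}(ca)^{k}b$ and $x\leq_{\mathcal L}((ca)^{k}c)^{*}$. (vi) There exist some $x\in S$ and some $k\in\mathbb{N}$ such that $cax(ca)^{k}c=(ca)^{k}c$, $x\mathrel{\mathcal R}(ca)^{k}b$ and $x\mathrel{\mathcal R^{\rm o}}((ca)^{k}c)^{*}$.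
   Context: $\mathbb{N}=\{0,1,2,\dots\}$. A $*$-monoid is a monoid $S$ with unity $1$ and an involution $*:S\to S$ satisfying $(a^* )^*=a$ and $(ab)^*=b^*a^*$ for all $a,b\in S$. Green's relations and preorders in $S$: $u\leq_{\mathcal L}v$ iff $Su\subseteq Sv$; $u\mathrel{\mathcal L}v$ iff $Su=Sv$; $u\leq_{\mathcal R}v$ iff $uS\subseteq vS$; $u\mathrel{\mathcal R}v$ iff $uS=vS$. Extended relations: $u\leq_{\mathcal R^{\rm o}}v$ means that $vs=vt$ implies $us=ut$ for all $s,t\in S$. $u\leq_{\mathcal L^{\rm o}}v$ means that $sv=tv$ implies $su=tu$ for all $s,t\in S$. $u\mathrel{\mathcal R^{\rm o}}v$ means that for all $s,t\in S$, $vs=vt$ iff $us=ut$. Definition: $a\in S$ is $(b,c)$-core-EP invertible if there exist $x\in S$ and $k\in\mathbb{N}$ such that $cax(ca)^{k}c=(ca)^{k}c$, $x\mathrel{\mathcal R}(ca)^{k}b$ and $x\mathrel{\mathcal L}((ca)^{k}c)^{*}$. *)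

theory Defs
  imports Main
begin

text \<open>The monoid \<open>S\<close> is the whole type \<open>'a\<close>, so elements of \<open>S\<close> need no membership premises.\<close>

class star_monoid = monoid_mult +
  fixes star :: "'a \<Rightarrow> 'a"
  assumes star_star: "star (star a) = a"
    and star_mult: "star (a * b) = star b * star a"

definition left_ideal_of :: "'a::monoid_mult \<Rightarrow> 'a set"
  where "left_ideal_of u = {s * u | s. True}"

definition right_ideal_of :: "'a::monoid_mult \<Rightarrow> 'a set"
  where "right_ideal_of u = {u * s | s. True}"

definition green_L_le :: "'a::monoid_mult \<Rightarrow> 'a \<Rightarrow> bool"
  where "green_L_le u v \<longleftrightarrow> left_ideal_of u \<subseteq> left_ideal_of v"

definition green_L :: "'a::monoid_mult \<Rightarrow> 'a \<Rightarrow> bool"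
  where "green_L u v \<longleftrightarrow> left_ideal_of u = left_ideal_of v"

definition green_R :: "'a::monoid_mult \<Rightarrow> 'a \<Rightarrow> bool"
  where "green_R u v \<longleftrightarrow> right_ideal_of u = right_ideal_of v"

text \<open>The extended relations compare annihilators: \<open>\<R>\<^sup>o\<close> concerns multiplication on the right
  and \<open>\<L>\<^sup>o\<close> multiplication on the left.\<close>

definition ext_R_le :: "'a::monoid_mult \<Rightarrow> 'a \<Rightarrow> bool"
  where "ext_R_le u v \<longleftrightarrow> (\<forall>s t. v * s = v * t \<longrightarrow> u * s = u * t)"

definition ext_L_le :: "'a::monoid_mult \<Rightarrow> 'a \<Rightarrow> bool"
  where "ext_L_le u v \<longleftrightarrow> (\<forall>s t. s * v = t * v \<longrightarrow> s * u = t * u)"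

definition ext_R :: "'a::monoid_mult \<Rightarrow> 'a \<Rightarrow> bool"
  where "ext_R u v \<longleftrightarrow> (\<forall>s t. v * s = v * t \<longleftrightarrow> u * s = u * t)"

text \<open>\<open>bc_core_EP_invertible b c a\<close> says that \<open>a\<close> is \<open>(b,c)\<close>-core-EP invertible.\<close>

definition bc_core_EP_invertible :: "'a::star_monoid \<Rightarrow> 'a \<Rightarrow> 'a \<Rightarrow> bool"
  where "bc_core_EP_invertible b c a \<longleftrightarrow>
    (\<exists>x. \<exists>k::nat. c * a * x * (c * a) ^ k * c = (c * a) ^ k * c \<and>
       green_R x ((c * a) ^ k * b) \<and> green_L x (star ((c * a) ^ k * c)))"

end

theory Submission
  imports Defs
begin

text \<open>Write \<open>w = ca\<close>, \<open>q = (ca)\<^sup>kb\<close> and \<open>r = (ca)\<^sup>kc\<close>. Conditions (i), (iv), (v), (vi) each imply \<open>x \<le> r\<^sup>*\<close> for the preorder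
  of \<open>\<R>\<^sup>o\<close>. Applying this preorder to \<open>r\<^sup>*(wx)\<^sup>* = r\<^sup>*\<close>, the adjoint of \<open>wxr = r\<close>, gives
  \<open>x(wx)\<^sup>* = x\<close>; so \<open>wx = wx(wx)\<^sup>*\<close> is self-adjoint and \<open>xwx = x\<close>. Conversely, in (ii) and (iii), \<open>x \<in> qS\<close> gives
  \<open>wx \<in> wqS \<subseteq> rS\<close>, so self-adjointness turns \<open>wx = ry\<close> into \<open>x = x(wx)\<^sup>* = xy\<^sup>*r\<^sup>*\<close>.\<close>

lemma right_ideal_of_iff: "x \<in> right_ideal_of u \<longleftrightarrow> (\<exists>s. x = u * s)"
  by (auto simp: right_ideal_of_def)

text \<open>The unity puts \<open>u\<close> into its own right ideal, so equality of ideals reduces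
  to a pair of right divisors, the form used in all later arguments.\<close>

lemma green_R_iff: "green_R u v \<longleftrightarrow> (\<exists>s. u = v * s) \<and> (\<exists>t. v = u * t)"
proof
  assume "green_R u v"
  moreover have "u \<in> right_ideal_of u" "v \<in> right_ideal_of v"
    unfolding right_ideal_of_iff by (metis mult_1_right)+
  ultimately show "(\<exists>s. u = v * s) \<and> (\<exists>t. v = u * t)"
    by (simp add: green_R_def flip: right_ideal_of_iff)
next
  assume "(\<exists>s. u = v * s) \<and> (\<exists>t. v = u * t)"
  then show "green_R u v"
    unfolding green_R_def set_eq_iff right_ideal_of_iff by (metis mult.assoc)
qed

lemma green_L_le_iff: "green_L_le u v \<longleftrightarrow> (\<exists>s. u = s * v)"
proof
  assume "green_L_le u v"
  moreover have "u \<in> left_ideal_of u"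
    unfolding left_ideal_of_def by (metis (mono_tags) mem_Collect_eq mult_1_left)
  ultimately show "\<exists>s. u = s * v"
    by (auto simp: green_L_le_def left_ideal_of_def)
next
  assume "\<exists>s. u = s * v"
  then show "green_L_le u v"
    by (auto simp: green_L_le_def left_ideal_of_def simp flip: mult.assoc)
qed

lemma green_L_iff: "green_L u v \<longleftrightarrow> green_L_le u v \<and> green_L_le v u"
  by (auto simp: green_L_def green_L_le_def)

lemma ext_R_iff: "ext_R u v \<longleftrightarrow> ext_R_le u v \<and> ext_R_le v u"
  by (auto simp: ext_R_def ext_R_le_def)

lemma ext_R_le_if_green_L_le: "green_L_le u v \<Longrightarrow> ext_R_le u v"
  by (auto simp: green_L_le_iff ext_R_le_def mult.assoc)

text \<open>The star turns the left factor \<open>w * x\<close> in \<open>fixed\<close> into a right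
  factor of \<open>star r\<close>, which is the side on which \<open>le\<close> transfers equations
  to \<open>x\<close>.\<close>

lemma
  fixes w x r :: "'a::star_monoid"
  assumes fixed: "w * x * r = r" and le: "ext_R_le x (star r)"
  shows self_adjoint_if_ext_R_le: "star (w * x) = w * x"
    and outer_inverse_if_ext_R_le: "x * w * x = x"
proof -
  \<comment> \<open>The explicit \<open>1\<close> gives the shape \<open>v * s = v * t\<close>
    required by \<open>ext_R_le\<close>.\<close>
  have "star r * star (w * x) = star r * 1"
    using arg_cong[OF fixed, of star] by (simp add: star_mult)
  then have x: "x * star (w * x) = x"
    using le unfolding ext_R_le_def by (metis mult_1_right)
  then have "w * x = (w * x) * star (w * x)"
    by (simp add: mult.assoc)
  \<comment> \<open>The right-hand side has the form \<open>u * star u\<close>, which the star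
    fixes.\<close>
  then show *: "star (w * x) = w * x"
    by (metis star_mult star_star)
  show "x * w * x = x"
    using x * by (simp add: mult.assoc)
qed

text \<open>Each of \<open>x\<close> and \<open>star r\<close> is a left multiple of the other: one
  direction stars \<open>range\<close> inside \<open>x = x * (w * x)\<close>, the other stars
  \<open>fixed\<close>.\<close>

lemma green_L_star_if_self_adjoint:
  fixes w x r y :: "'a::star_monoid"
  assumes fixed: "w * x * r = r" and adj: "star (w * x) = w * x"
    and outer: "x * w * x = x" and range: "w * x = r * y"
  shows "green_L x (star r)"
proof -
  have "x = x * star y * star r"
    using outer adj range by (metis mult.assoc star_mult)
  moreover have "star r = star r * w * x"
    using fixed adj by (metis mult.assoc star_mult)
  ultimately show ?thesis
    unfolding green_L_iff green_L_le_iff by blast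
qed

text \<open>This leads from (iii) back to (i): membership and \<open>absorb\<close> make
  \<open>x\<close> and \<open>(c * a) ^ k * b\<close> right multiples of each other.\<close>

lemma
  fixes a b c x :: "'a::star_monoid"
  assumes mem: "x \<in> right_ideal_of ((c * a) ^ k * b)"
    and fixed: "c * a * x * (c * a) ^ k * c = (c * a) ^ k * c"
    and absorb: "x * (c * a) ^ (k + 1) * b = (c * a) ^ k * b"
    and adj: "star (c * a * x) = c * a * x"
  shows green_R_if_absorb: "green_R x ((c * a) ^ k * b)"
    and green_L_if_absorb: "green_L x (star ((c * a) ^ k * c))"
    and ext_L_le_if_absorb: "ext_L_le ((c * a) ^ k * b) x"
proof -
  define w where "w = c * a"
  obtain s where s: "x = w ^ k * b * s"
    using mem by (auto simp: right_ideal_of_iff w_def)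
  have q: "w ^ k * b = x * (w * (w ^ k * b))"
    using absorb by (simp add: w_def mult.assoc)
  show "green_R x ((c * a) ^ k * b)"
    using s q unfolding green_R_iff w_def by blast
  show "ext_L_le ((c * a) ^ k * b) x"
    using q unfolding ext_L_le_def w_def by (metis mult.assoc)
  \<comment> \<open>With \<open>q = w ^ k * b\<close> and \<open>x = q * s\<close>, the identity
    \<open>x * w * q = q\<close> is multiplied by \<open>s\<close> on the right.\<close>
  have outer: "x * w * x = x"
    using s q by (metis mult.assoc)
  \<comment> \<open>Moving the new \<open>w\<close> behind \<open>w ^ k\<close> and splitting it as
    \<open>c * a\<close> exposes the left factor \<open>w ^ k * c\<close>.\<close>
  have "w * x = w ^ k * w * b * s"
    using s by (simp add: power_commutes flip: mult.assoc)
  then have range: "w * x = w ^ k * c * (a * b * s)"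
    by (simp add: w_def mult.assoc)
  show "green_L x (star ((c * a) ^ k * c))"
    using green_L_star_if_self_adjoint[OF _ _ outer range] fixed adj
    by (simp add: w_def mult.assoc)
qed

text \<open>This leads from (iv) to (ii).\<close>

lemma
  fixes a b c x :: "'a::star_monoid"
  assumes fixed: "c * a * x * (c * a) ^ k * c = (c * a) ^ k * c"
    and le: "ext_R_le x (star ((c * a) ^ k * c))"
    and L_le: "ext_L_le ((c * a) ^ k * b) x"
  shows self_adjoint_if_ext: "star (c * a * x) = c * a * x"
    and outer_inverse_if_ext: "x * c * a * x = x"
    and absorb_if_ext: "x * (c * a) ^ (k + 1) * b = (c * a) ^ k * b"
proof -
  have "c * a * x * ((c * a) ^ k * c) = (c * a) ^ k * c"
    using fixed by (simp add: mult.assoc)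
  note * = self_adjoint_if_ext_R_le[OF this le] outer_inverse_if_ext_R_le[OF this le]
  show "star (c * a * x) = c * a * x" by fact
  show "x * c * a * x = x"
    using *(2) by (simp add: mult.assoc)
  \<comment> \<open>The outer inverse law, read as \<open>x * (c * a) * x = 1 * x\<close>, is
    carried by \<open>L_le\<close> from \<open>x\<close> to \<open>(c * a) ^ k * b\<close>.\<close>
  have "x * (c * a) * ((c * a) ^ k * b) = 1 * ((c * a) ^ k * b)"
    using L_le *(2) unfolding ext_L_le_def by (metis mult_1_left)
  then show "x * (c * a) ^ (k + 1) * b = (c * a) ^ k * b"
    by (simp add: mult.assoc)
qed

lemma ext_L_le_if_green_R: "green_R x u \<Longrightarrow> ext_L_le u x"
  unfolding green_R_iff ext_L_le_def by (metis mult.assoc)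

lemma mem_right_ideal_if_green_R: "green_R x u \<Longrightarrow> x \<in> right_ideal_of u"
  by (simp add: green_R_iff right_ideal_of_iff)

theorem theorem3p7:
  fixes a b c :: "'a::star_monoid"
  defines "cond_i \<equiv> bc_core_EP_invertible b c a"
    and "cond_ii \<equiv> (\<exists>k::nat. \<exists>x \<in> right_ideal_of ((c * a) ^ k * b).
        c * a * x * (c * a) ^ k * c = (c * a) ^ k * c \<and>
        x * (c * a) ^ (k + 1) * b = (c * a) ^ k * b \<and>
        star (c * a * x) = c * a * x \<and> x * c * a * x = x)"
    and "cond_iii \<equiv> (\<exists>k::nat. \<exists>x \<in> right_ideal_of ((c * a) ^ k * b).
        c * a * x * (c * a) ^ k * c = (c * a) ^ k * c \<and>
        x * (c * a) ^ (k + 1) * b = (c * a) ^ k * b \<and>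
        star (c * a * x) = c * a * x)"
    and "cond_iv \<equiv> (\<exists>k::nat. \<exists>x \<in> right_ideal_of ((c * a) ^ k * b).
        c * a * x * (c * a) ^ k * c = (c * a) ^ k * c \<and>
        ext_L_le ((c * a) ^ k * b) x \<and> ext_R_le x (star ((c * a) ^ k * c)))"
    and "cond_v \<equiv> (\<exists>x. \<exists>k::nat.
        c * a * x * (c * a) ^ k * c = (c * a) ^ k * c \<and>
        green_R x ((c * a) ^ k * b) \<and> green_L_le x (star ((c * a) ^ k * c)))"
    and "cond_vi \<equiv> (\<exists>x. \<exists>k::nat.
        c * a * x * (c * a) ^ k * c = (c * a) ^ k * c \<and>
        green_R x ((c * a) ^ k * b) \<and> ext_R x (star ((c * a) ^ k * c)))"
  shows "(cond_i \<longleftrightarrow> cond_ii) \<and> (cond_i \<longleftrightarrow> cond_iii) \<and> (cond_i \<longleftrightarrow> cond_iv) \<and>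
    (cond_i \<longleftrightarrow> cond_v) \<and> (cond_i \<longleftrightarrow> cond_vi)"
proof -
  \<comment> \<open>Every implication below keeps the same \<open>x\<close> and \<open>k\<close>;
    only the conditions on them change.\<close>
  have i_v: "cond_v" if "cond_i"
    using that unfolding cond_i_def cond_v_def bc_core_EP_invertible_def green_L_iff by blast
  have i_vi: "cond_vi" if "cond_i"
  proof -
    have "ext_R u v" if "green_L u v" for u v :: 'a
      using that by (simp add: green_L_iff ext_R_iff ext_R_le_if_green_L_le)
    with that show ?thesis
      unfolding cond_i_def cond_vi_def bc_core_EP_invertible_def by blast
  qed
  have v_iv: "cond_iv" if "cond_v"
    using that unfolding cond_v_def cond_iv_def
    by (meson ext_R_le_if_green_L_le ext_L_le_if_green_R mem_right_ideal_if_green_R)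
  have vi_iv: "cond_iv" if "cond_vi"
    using that unfolding cond_vi_def cond_iv_def ext_R_iff
    by (meson ext_L_le_if_green_R mem_right_ideal_if_green_R)
  have iv_ii: "cond_ii" if "cond_iv"
    using that unfolding cond_iv_def cond_ii_def
    by (meson self_adjoint_if_ext outer_inverse_if_ext absorb_if_ext)
  have ii_iii: "cond_iii" if "cond_ii"
    using that unfolding cond_ii_def cond_iii_def by blast
  have iii_i: "cond_i" if "cond_iii"
    using that unfolding cond_iii_def cond_i_def bc_core_EP_invertible_def
    by (meson green_R_if_absorb green_L_if_absorb)
  show ?thesis
    using i_v i_vi v_iv vi_iv iv_ii ii_iii iii_i by blast
qed

end
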